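(* Let $k\ge1$ be an integer. (1) If $\dfrac{a_{2k-2}}{a_{2k-1}}<\dfrac{\lambda_1}{-\lambda_2}\le\dfrac{a'_{2k-1}}{a'_{2k}}$, then $L_{2k-1}$ is the lowest weight vector of $B_0(\lambda)$. (2) If $\dfrac{a'_{2k-1}}{a'_{2k}}<\dfrac{\lambda_1}{-\lambda_2}\le\dfrac{a_{2k}}{a_{2k+1}}$, then $L_{2k}$ is the lowest weight vector of $B_0(\lambda)$.
   Context: Setting. Let $c_1,c_2$ be positive integers with $c_1c_2\ge 4$, and let $\mathfrak g$ be the rank 2 Kac–Moody algebra (of affine or hyperbolic type), $I=\{1,2\}$, with simple roots $\alpha_i$, simple coroots $h_i$ and Cartan matrix $\langle h_1,\alpha_1\rangle=\langle h_2,\alpha_2\rangle=2$, $\langle h_1,\alpha_2\rangle=-c_1$, $\langle h_2,\alpha_1\rangle=-c_2$. Let $\lambda=\lambda_1\Lambda_1+\lambda_2\Lambda_2$ with $\Lambda_i$ the fundamental weights (so $\langle h_i,\lambda\rangle=\lambda_i$), $\lambda_1\in\mathbb Z_{>0}$, $\lambda_2\in\mathbb Z_{<0}$. The crystal $\mathbb Z^\infty_\iota[\lambda]$. Fix $\iota=(\dots,i_2,i_1,t_\lambda,i_{-1},i_{-2},\dots)=(\dots,1,2,1,t_\lambda,2,1,2,\dots)$, i.e. $i_k=1$ for $k>0$ odd, $i_k=2$ for $k>0$ even, $i_{-k}=2$ for $k>0$ odd, $i_{-k}=1$ for $k>0$ even. As a set, $\mathbb Z^\infty_\iota[\lambda]$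 consists of the sequences $\vec x=(\dots,x_2,x_1,t_\lambda,x_{-1},x_{-2},\dots)$ with $x_k\in\mathbb Z$ ($k\in\mathbb Z\setminus\{0\}$), all but finitely many zero ($t_\lambda$ is a formal symbol). There is no coordinate $x_0$; sums run over nonzero indices. Put $\sigma_k(\vec x)=x_k+\sum_{j>k}\langle h_{i_k},\alpha_{i_j}\rangle x_j$ for $k\ge1$ and $\sigma_k(\vec x)=-\langle h_{i_k},\lambda\rangle+x_k+\sum_{j>k}\langle h_{i_k},\alpha_{i_j}\rangle x_j$ for $k\le -1$. Let $\sigma^{(i)}(\vec x)=\max_{k:\,i_k=i}\sigma_k(\vec x)$ and $M^{(i)}=\{k: i_k=i,\ \sigma_k(\vec x)=\sigma^{(i)}(\vec x)\}$. The crystal operators are: $\tilde e_i\vec x$ is obtained from $\vec x$ by decreasing $x_{\max M^{(i)}}$ by 1 if $\max M^{(i)}$ exists, and $\tilde e_i\vec x=0$ otherwise; $\tilde f_i\vec x$ is obtained from $\vec x$ by increasing $x_{\min M^{(i)}}$ by 1 if $\min M^{(i)}$ exists, and $\tilde f_i\vec x=0$ otherwise. Also $wt(\vec x)=\lambda-\sum_j x_j\alpha_{i_j}$, $\varepsilon_i(\vec x)=\sigma^{(i)}(\vec x)$, $\varphi_i(\vec x)=\langle h_i,wt(\vec x)\rangle+\varepsilon_i(\vec x)$. $B_0(\lambda)$. The crystal $B(U_q(\mathfrak g)a_\lambda)\cong B(\infty)\otimes T_\lambda\otimes B(-\infty)$ of the modified quantum algebra is identified with its image under the unique strict embedding into $\mathbb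 Z^\infty_\iota[\lambda]$ sending $u_\infty\otimes t_\lambda\otimes u_{-\infty}$ to $(\dots,0,0,t_\lambda,0,0,\dots)$. $B_0(\lambda)$ is its connected component containing $u_\infty\otimes t_\lambda\otimes u_{-\infty}$; equivalently, the connected component of $(\dots,0,0,t_\lambda,0,0,\dots)$ in $\mathbb Z^\infty_\iota[\lambda]$. A lowest weight vector of a crystal is an element $b$ with $\tilde f_ib=0$ for all $i\in I$. The integers $a_l,a'_l$. The Chebyshev polynomials $P_k(X)$ ($k\ge0$) are defined by $P_k(\alpha+\alpha^{-1})=\dfrac{\alpha^{k+1}-\alpha^{-k-1}}{\alpha-\alpha^{-1}}$. With $X=c_1c_2-2$: $a_0=a'_0=0$, $a_1=a'_1=1$, and for $k\ge1$: $a_{2k}=c_1P_{k-1}(X)$, $a'_{2k}=c_2P_{k-1}(X)$, $a_{2k+1}=a'_{2k+1}=P_k(X)+P_{k-1}(X)$. The vectors $L_j$. For $k,j\ge1$: $l_{2k-1}=a_{2k-1}\lambda_1+a_{2k-2}\lambda_2$, $l_{2k}=a'_{2k}\lambda_1+a'_{2k-1}\lambda_2$, and $L_j=(\dots,0,0,l_j,l_{j-1},\dots,l_2,l_1,t_\lambda,0,0,\dots)$. *)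

theory Defs
  imports Complex_Main "HOL-Computational_Algebra.Polynomial"
begin

section \<open>The crystal $Z^\infty_\iota[\lambda]$ in rank two\<close>

datatype idx = I1 | I2

text \<open>The Cartan matrix: \<^term>\<open>cartan c1 c2 i j\<close> is the pairing of the coroot $h_i$ with the
  root $\alpha_j$.\<close>

definition cartan :: "int \<Rightarrow> int \<Rightarrow> idx \<Rightarrow> idx \<Rightarrow> int" where
  "cartan c1 c2 i j = (if i = j then 2 else if i = I1 then - c1 else - c2)"

text \<open>The weight $\lambda = \lambda_1 \Lambda_1 + \lambda_2 \Lambda_2$ enters only through its
  pairings with the coroots.\<close>

definition weight_pairing :: "int \<Rightarrow> int \<Rightarrow> idx \<Rightarrow> int" where
  "weight_pairing lam1 lam2 i = (if i = I1 then lam1 else lam2)"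

text \<open>The index sequence $\iota$. Only its values at nonzero positions are meaningful: position 0
  is taken by the formal symbol $t_\lambda$.\<close>

definition iota :: "int \<Rightarrow> idx" where
  "iota k = (if k > 0 then (if odd k then I1 else I2) else (if odd k then I2 else I1))"

text \<open>A sequence is a function on all integers; as there is no coordinate $x_0$, the value at 0
  is fixed to be 0.\<close>

definition Zinf :: "(int \<Rightarrow> int) set" where
  "Zinf = {x. x 0 = 0 \<and> finite {k. x k \<noteq> 0}}"

text \<open>The sum over $j > k$ is restricted to the support of $x$ because \<^const>\<open>sum\<close> over an
  infinite set is 0.\<close>

definition sigma :: "int \<Rightarrow> int \<Rightarrow> int \<Rightarrow> int \<Rightarrow> (int \<Rightarrow> int) \<Rightarrow> int \<Rightarrow> int" where
  "sigma c1 c2 lam1 lam2 x k =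
     (if k < 0 then - weight_pairing lam1 lam2 (iota k) else 0) + x k
     + (\<Sum>j \<in> {j. j > k \<and> j \<noteq> 0 \<and> x j \<noteq> 0}. cartan c1 c2 (iota k) (iota j) * x j)"

definition positions :: "idx \<Rightarrow> int set" where
  "positions i = {k. k \<noteq> 0 \<and> iota k = i}"

text \<open>For a sequence in \<^const>\<open>Zinf\<close> the set of values is finite, so that \<^const>\<open>Max\<close> is the
  maximum (see \<open>finite_sigma_image\<close> below).\<close>

definition sigma_max :: "int \<Rightarrow> int \<Rightarrow> int \<Rightarrow> int \<Rightarrow> idx \<Rightarrow> (int \<Rightarrow> int) \<Rightarrow> int" where
  "sigma_max c1 c2 lam1 lam2 i x = Max (sigma c1 c2 lam1 lam2 x ` positions i)"

definition Mset :: "int \<Rightarrow> int \<Rightarrow> int \<Rightarrow> int \<Rightarrow> idx \<Rightarrow> (int \<Rightarrow> int) \<Rightarrow> int set" where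
  "Mset c1 c2 lam1 lam2 i x =
     {k \<in> positions i. sigma c1 c2 lam1 lam2 x k = sigma_max c1 c2 lam1 lam2 i x}"

text \<open>The value \<^const>\<open>None\<close> plays the role of the crystal element 0. The set $M^{(i)}$ may be
  infinite while having a greatest or a least element, hence \<^const>\<open>Greatest\<close> and
  \<^const>\<open>Least\<close> instead of \<^const>\<open>Max\<close> and \<^const>\<open>Min\<close>.\<close>

definition e_op :: "int \<Rightarrow> int \<Rightarrow> int \<Rightarrow> int \<Rightarrow> idx \<Rightarrow> (int \<Rightarrow> int) \<Rightarrow> (int \<Rightarrow> int) option" where
  "e_op c1 c2 lam1 lam2 i x =
     (if \<exists>m \<in> Mset c1 c2 lam1 lam2 i x. \<forall>k \<in> Mset c1 c2 lam1 lam2 i x. k \<le> m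
      then let m = (GREATEST k. k \<in> Mset c1 c2 lam1 lam2 i x) in Some (x(m := x m - 1))
      else None)"

definition f_op :: "int \<Rightarrow> int \<Rightarrow> int \<Rightarrow> int \<Rightarrow> idx \<Rightarrow> (int \<Rightarrow> int) \<Rightarrow> (int \<Rightarrow> int) option" where
  "f_op c1 c2 lam1 lam2 i x =
     (if \<exists>m \<in> Mset c1 c2 lam1 lam2 i x. \<forall>k \<in> Mset c1 c2 lam1 lam2 i x. m \<le> k
      then let m = (LEAST k. k \<in> Mset c1 c2 lam1 lam2 i x) in Some (x(m := x m + 1))
      else None)"

definition crystal_edges :: "int \<Rightarrow> int \<Rightarrow> int \<Rightarrow> int \<Rightarrow> ((int \<Rightarrow> int) \<times> (int \<Rightarrow> int)) set" where
  "crystal_edges c1 c2 lam1 lam2 =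
     {(x, y). x \<in> Zinf \<and> y \<in> Zinf \<and>
        (\<exists>i. e_op c1 c2 lam1 lam2 i x = Some y \<or> f_op c1 c2 lam1 lam2 i x = Some y)}"

text \<open>$B_0(\lambda)$: the connected component, in the undirected crystal graph, of the sequence
  that vanishes identically.\<close>

definition B0 :: "int \<Rightarrow> int \<Rightarrow> int \<Rightarrow> int \<Rightarrow> (int \<Rightarrow> int) set" where
  "B0 c1 c2 lam1 lam2 =
     {x. ((\<lambda>_. 0), x) \<in> (crystal_edges c1 c2 lam1 lam2 \<union> (crystal_edges c1 c2 lam1 lam2)\<inverse>)\<^sup>*}"

definition lowest_weight_vector ::
    "int \<Rightarrow> int \<Rightarrow> int \<Rightarrow> int \<Rightarrow> (int \<Rightarrow> int) set \<Rightarrow> (int \<Rightarrow> int) \<Rightarrow> bool" where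
  "lowest_weight_vector c1 c2 lam1 lam2 B b \<longleftrightarrow> b \<in> B \<and> (\<forall>i. f_op c1 c2 lam1 lam2 i b = None)"

section \<open>Chebyshev polynomials and the vectors $L_j$\<close>

text \<open>The condition on $\alpha$ says that the denominator is defined and nonzero.\<close>

definition is_chebyshev :: "nat \<Rightarrow> int poly \<Rightarrow> bool" where
  "is_chebyshev k p \<longleftrightarrow>
     (\<forall>\<alpha>::complex. \<alpha> \<noteq> 0 \<and> \<alpha> - inverse \<alpha> \<noteq> 0 \<longrightarrow>
        poly (map_poly of_int p) (\<alpha> + inverse \<alpha>)
          = (\<alpha> ^ (k + 1) - inverse \<alpha> ^ (k + 1)) / (\<alpha> - inverse \<alpha>))"

definition chebyshev_P :: "nat \<Rightarrow> int poly" where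
  "chebyshev_P k = (THE p. is_chebyshev k p)"

text \<open>The sequences $a_l$ and $a'_l$; for $l \ge 2$ put $k = \lfloor l/2 \rfloor \ge 1$.\<close>

definition a_seq :: "int \<Rightarrow> int \<Rightarrow> nat \<Rightarrow> int" where
  "a_seq c1 c2 l =
     (let k = l div 2; X = c1 * c2 - 2 in
      if l = 0 then 0 else if l = 1 then 1
      else if even l then c1 * poly (chebyshev_P (k - 1)) X
      else poly (chebyshev_P k) X + poly (chebyshev_P (k - 1)) X)"

definition a'_seq :: "int \<Rightarrow> int \<Rightarrow> nat \<Rightarrow> int" where
  "a'_seq c1 c2 l =
     (let k = l div 2; X = c1 * c2 - 2 in
      if l = 0 then 0 else if l = 1 then 1
      else if even l then c2 * poly (chebyshev_P (k - 1)) X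
      else poly (chebyshev_P k) X + poly (chebyshev_P (k - 1)) X)"

text \<open>Meaningful for $j \ge 1$.\<close>

definition l_seq :: "int \<Rightarrow> int \<Rightarrow> int \<Rightarrow> int \<Rightarrow> nat \<Rightarrow> int" where
  "l_seq c1 c2 lam1 lam2 j =
     (if odd j then a_seq c1 c2 j * lam1 + a_seq c1 c2 (j - 1) * lam2
      else a'_seq c1 c2 j * lam1 + a'_seq c1 c2 (j - 1) * lam2)"

definition L_vec :: "int \<Rightarrow> int \<Rightarrow> int \<Rightarrow> int \<Rightarrow> nat \<Rightarrow> (int \<Rightarrow> int)" where
  "L_vec c1 c2 lam1 lam2 j =
     (\<lambda>k. if 1 \<le> k \<and> k \<le> int j then l_seq c1 c2 lam1 lam2 (nat k) else 0)"

section \<open>Well-definedness\<close>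

fun cheb_rec :: "nat \<Rightarrow> int poly" where
  "cheb_rec 0 = 1"
| "cheb_rec (Suc 0) = [:0, 1:]"
| "cheb_rec (Suc (Suc k)) = [:0, 1:] * cheb_rec (Suc k) - cheb_rec k"

lemma map_poly_of_int_diff:
  "map_poly (of_int :: int \<Rightarrow> complex) (p - q) = map_poly of_int p - map_poly of_int q"
  by (rule poly_eqI) (simp add: coeff_map_poly)

lemma map_poly_of_int_shift:
  "map_poly (of_int :: int \<Rightarrow> complex) ([:0, 1:] * p) = [:0, 1:] * map_poly of_int p"
  by (rule poly_eqI) (simp add: coeff_map_poly coeff_pCons split: nat.split)

lemma is_chebyshev_cheb_rec: "is_chebyshev k (cheb_rec k)"
proof (induction k rule: cheb_rec.induct)
  case 1
  show ?case by (simp add: is_chebyshev_def)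
next
  case 2
  have "(\<alpha> + inverse \<alpha>) * (\<alpha> - inverse \<alpha>) = \<alpha>\<^sup>2 - inverse \<alpha> ^ 2" for \<alpha> :: complex
    by (simp add: power2_eq_square algebra_simps)
  then show ?case
    by (auto simp: is_chebyshev_def map_poly_pCons numeral_2_eq_2[symmetric] eq_divide_eq
        simp del: power_inverse)
next
  case (3 k)
  show ?case
    unfolding is_chebyshev_def
  proof (intro allI impI)
    fix \<alpha> :: complex
    assume A: "\<alpha> \<noteq> 0 \<and> \<alpha> - inverse \<alpha> \<noteq> 0"
    define \<beta> where "\<beta> = inverse \<alpha>"
    have ab: "\<alpha> * \<beta> = 1" using A by (simp add: \<beta>_def)
    have 1: "(\<alpha> + \<beta>) * (\<alpha> ^ (k + 2) - \<beta> ^ (k + 2)) - (\<alpha> ^ (k + 1) - \<beta> ^ (k + 1))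
           = \<alpha> ^ (k + 3) - \<beta> ^ (k + 3)"
    proof -
      have "\<beta> * \<alpha> ^ (k + 2) = (\<alpha> * \<beta>) * \<alpha> ^ (k + 1)" "\<alpha> * \<beta> ^ (k + 2) = (\<alpha> * \<beta>) * \<beta> ^ (k + 1)"
        by (simp_all add: algebra_simps)
      then have "\<beta> * \<alpha> ^ (k + 2) = \<alpha> ^ (k + 1)" "\<alpha> * \<beta> ^ (k + 2) = \<beta> ^ (k + 1)"
        by (simp_all only: ab mult_1)
      moreover have "\<alpha> ^ (k + 3) = \<alpha> * \<alpha> ^ (k + 2)" "\<beta> ^ (k + 3) = \<beta> * \<beta> ^ (k + 2)"
        by (simp_all add: numeral_3_eq_3)
      ultimately show ?thesis by (simp only: ring_distribs) (simp only: algebra_simps)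
    qed
    have "poly (map_poly of_int (cheb_rec (Suc (Suc k)))) (\<alpha> + \<beta>)
        = (\<alpha> + \<beta>) * poly (map_poly of_int (cheb_rec (Suc k))) (\<alpha> + \<beta>)
          - poly (map_poly of_int (cheb_rec k)) (\<alpha> + \<beta>)"
      by (simp only: cheb_rec.simps map_poly_of_int_diff map_poly_of_int_shift) simp
    also have "\<dots> = (\<alpha> + \<beta>) * ((\<alpha> ^ (k + 2) - \<beta> ^ (k + 2)) / (\<alpha> - \<beta>))
          - (\<alpha> ^ (k + 1) - \<beta> ^ (k + 1)) / (\<alpha> - \<beta>)"
      using 3 A unfolding is_chebyshev_def \<beta>_def by simp
    also have "\<dots> = ((\<alpha> + \<beta>) * (\<alpha> ^ (k + 2) - \<beta> ^ (k + 2)) - (\<alpha> ^ (k + 1) - \<beta> ^ (k + 1))) / (\<alpha> - \<beta>)"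
      by (simp add: diff_divide_distrib right_diff_distrib)
    also have "\<dots> = (\<alpha> ^ (k + 3) - \<beta> ^ (k + 3)) / (\<alpha> - \<beta>)" by (simp only: 1)
    finally show "poly (map_poly of_int (cheb_rec (Suc (Suc k)))) (\<alpha> + inverse \<alpha>)
        = (\<alpha> ^ (Suc (Suc k) + 1) - inverse \<alpha> ^ (Suc (Suc k) + 1)) / (\<alpha> - inverse \<alpha>)"
      by (simp only: \<beta>_def) (simp add: eval_nat_numeral)
  qed
qed

lemma is_chebyshev_unique:
  assumes "is_chebyshev k p" "is_chebyshev k q"
  shows "p = q"
proof -
  define h :: "real \<Rightarrow> complex" where "h t = of_real t + inverse (of_real t)" for t
  have inj: "inj_on h {1<..}"
  proof (rule inj_onI)
    fix s t :: real assume st: "s \<in> {1<..}" "t \<in> {1<..}" "h s = h t"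
    have "s + inverse s = t + inverse t"
      using st(3) unfolding h_def of_real_inverse[symmetric] of_real_add[symmetric] of_real_eq_iff .
    then have "(s - t) * (s * t - 1) = 0" using st(1,2) by (simp add: field_simps)
    moreover have "s * t > 1" using st(1,2) by (simp add: less_1_mult)
    ultimately show "s = t" by simp
  qed
  let ?r = "map_poly (of_int :: int \<Rightarrow> complex) p - map_poly of_int q"
  have "h ` {1<..} \<subseteq> {z. poly ?r z = 0}"
  proof clarify
    fix t :: real assume t: "1 < t"
    have "inverse t < 1" using t by (simp add: inverse_less_1_iff)
    then have "t - inverse t \<noteq> 0" using t by simp
    then have "complex_of_real t - inverse (complex_of_real t) \<noteq> 0"
      unfolding of_real_inverse[symmetric] of_real_diff[symmetric] of_real_eq_0_iff .
    then show "poly ?r (h t) = 0"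
      using assms t unfolding is_chebyshev_def h_def by simp
  qed
  moreover have "infinite (h ` {1<..})"
    using inj finite_imageD infinite_Ioi by blast
  ultimately have "infinite {z. poly ?r z = 0}" using finite_subset by blast
  then have "?r = 0" using poly_roots_finite by blast
  then have "coeff (map_poly (of_int :: int \<Rightarrow> complex) p) n = coeff (map_poly of_int q) n" for n
    by simp
  then show ?thesis by (intro poly_eqI) (simp add: coeff_map_poly)
qed

lemma chebyshev_P_eq_cheb_rec: "chebyshev_P k = cheb_rec k"
  unfolding chebyshev_P_def using is_chebyshev_cheb_rec is_chebyshev_unique by blast

lemma finite_sigma_image:
  assumes "x \<in> Zinf"
  shows "finite (sigma c1 c2 lam1 lam2 x ` A)"
proof -
  let ?S = "{k. x k \<noteq> 0}"
  have fin: "finite ?S" using assms by (simp add: Zinf_def)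
  let ?g = "\<lambda>(i, T, b, y). (if b then - weight_pairing lam1 lam2 i else 0) + y
              + (\<Sum>j\<in>T. cartan c1 c2 i (iota j) * x j)"
  have "sigma c1 c2 lam1 lam2 x ` A \<subseteq> ?g ` ({I1, I2} \<times> Pow ?S \<times> UNIV \<times> insert 0 (x ` ?S))"
  proof
    fix v assume "v \<in> sigma c1 c2 lam1 lam2 x ` A"
    then obtain k where v: "v = sigma c1 c2 lam1 lam2 x k" by blast
    have "v = ?g (iota k, {j. j > k \<and> j \<noteq> 0 \<and> x j \<noteq> 0}, k < 0, x k)"
      by (simp add: v sigma_def)
    moreover have "(iota k, {j. j > k \<and> j \<noteq> 0 \<and> x j \<noteq> 0}, k < 0, x k)
        \<in> {I1, I2} \<times> Pow ?S \<times> UNIV \<times> insert 0 (x ` ?S)"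
      by (auto simp: iota_def)
    ultimately show "v \<in> ?g ` ({I1, I2} \<times> Pow ?S \<times> UNIV \<times> insert 0 (x ` ?S))" by blast
  qed
  moreover have "finite (?g ` ({I1, I2} \<times> Pow ?S \<times> (UNIV :: bool set) \<times> insert 0 (x ` ?S)))"
    using fin by (intro finite_imageI finite_cartesian_product) auto
  ultimately show ?thesis using finite_subset by blast
qed

end

theory Submission
  imports Defs
begin

text \<open>
  Write \<open>ell n\<close> for the numbers $l_n$, continued by \<open>0\<close> to \<open>n \<le> 0\<close>. They satisfy
  $l_{n+2} = c\,l_{n+1} - l_n$, where \<open>c\<close> alternates between \<open>c1\<close> and \<open>c2\<close>, except that at the
  two steps across $t_\lambda$ the labels $\lambda_1$ and $\lambda_2$ are added. These are exactly the
  labels that enter the differences of consecutive $\sigma_k$ of the same colour. Hence, in terms of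
  the deficit \<open>Y n = ell n - x n\<close>, all these differences are given by one homogeneous three-term
  expression (\<open>s_diff\<close>): passing to \<open>Y\<close> pushes $t_\lambda$ to the left of position \<open>j\<close> and
  turns $L_j$ into the zero vector. The two hypotheses on $\lambda_1 / (-\lambda_2)$ say
  \<open>ell j > 0\<close> and \<open>ell (j + 1) \<le> 0\<close>, that is, the weight seen after this move is
  antidominant, so the component should look like a lowest weight crystal with lowest weight
  vector \<open>Y = 0\<close>.

  Existence. Applying $\tilde f_{i_m}$ exactly $l_m$ times to $L_{m-1}$ gives $L_m$
  (\<open>L_vec_step\<close>). For this all of \<open>ell 1, \<dots>, ell j\<close> have to be positive, which holds because a
  solution of the recurrence that has become nonpositive stays so (\<open>ell_nonpos_persists\<close>; here
  \<open>c1 * c2 \<ge> 4\<close> is needed). So $L_j$ lies in the component of the zero vector.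

  Uniqueness. The component is enclosed in a polyhedron given by linear inequalities in the
  sense of Nakashima and Zelevinsky. The deficits \<open>Y n\<close>, \<open>n \<le> j\<close>, are to be nonnegative, and this
  family of inequalities is completed so that each functional, minus a multiple of a
  $\sigma$-difference, is again in the family (\<open>phi_Suc\<close>); this makes the polyhedron stable under
  the crystal operators (\<open>polyhedron_f\<close>, \<open>polyhedron_e\<close>). It contains $L_j$, hence
  the component. In it, an element other than $L_j$ has a lowest position \<open>n\<close> with \<open>Y n > 0\<close>;
  there $\sigma$ exceeds the values at all lower positions of the same colour, so the
  minimum of $M^{(i)}$ exists and $\tilde f_i$ does not vanish (\<open>polyhedron_f_at\<close>).
\<close>

section \<open>Positive solutions of three-term recurrences\<close>

text \<open>The bound \<open>2 * u l \<le> d l * u (Suc l)\<close> says that the ratio of consecutive terms stays above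
  the one of the borderline case $d_l d_{l+1} = 4$. Unlike nonnegativity alone it
  is inherited from one step to the next.\<close>

lemma three_term_nonneg:
  fixes u d :: "nat \<Rightarrow> int"
  assumes d: "\<And>l. d l > 0" and dd: "\<And>l. d l * d (Suc l) \<ge> 4"
    and rec: "\<And>l. u (Suc (Suc l)) = d l * u (Suc l) - u l"
    and u0: "0 \<le> u 0" and u1: "2 * u 0 \<le> d 0 * u 1"
  shows "0 \<le> u l \<and> 2 * u l \<le> d l * u (Suc l)"
proof (induction l)
  case 0
  then show ?case using u0 u1 by simp
next
  case (Suc l)
  have "0 \<le> d l * u (Suc l)" using Suc by linarith
  then have nn: "0 \<le> u (Suc l)" using d[of l] by (simp add: zero_le_mult_iff)
  have "d (Suc l) * (2 * u l) \<le> d (Suc l) * (d l * u (Suc l))"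
    using Suc d[of "Suc l"] by (intro mult_left_mono) auto
  moreover have "4 * u (Suc l) \<le> (d l * d (Suc l)) * u (Suc l)"
    using dd[of l] nn by (intro mult_right_mono)
  moreover have "d (Suc l) * u (Suc (Suc l)) = (d l * d (Suc l)) * u (Suc l) - d (Suc l) * u l"
    by (simp add: rec algebra_simps)
  ultimately have "2 * u (Suc l) \<le> d (Suc l) * u (Suc (Suc l))" by (simp add: algebra_simps)
  with nn show ?case by simp
qed

lemma three_term_pos:
  fixes u d :: "nat \<Rightarrow> int"
  assumes d: "\<And>l. d l > 0" and dd: "\<And>l. d l * d (Suc l) \<ge> 4"
    and rec: "\<And>l. u (Suc (Suc l)) = d l * u (Suc l) - u l"
    and u0: "u 0 = 0" and u1: "u 1 = 1"
  shows "0 < u (Suc l)"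
proof (induction l)
  case 0
  then show ?case using u1 by simp
next
  case (Suc l)
  have "2 * u (Suc l) \<le> d (Suc l) * u (Suc (Suc l))"
    using three_term_nonneg[of d u "Suc l", OF d dd rec] u0 u1 d[of 0] by simp
  then have "0 < d (Suc l) * u (Suc (Suc l))" using Suc by linarith
  then show ?case using d[of "Suc l"] by (simp add: zero_less_mult_iff)
qed

section \<open>The sequences $a_l$ and $a'_l$\<close>

lemma poly_chebyshev_P:
  "poly (chebyshev_P 0) X = 1" "poly (chebyshev_P (Suc 0)) X = X"
  "poly (chebyshev_P (Suc (Suc k))) X = X * poly (chebyshev_P (Suc k)) X - poly (chebyshev_P k) X"
  by (simp_all add: chebyshev_P_eq_cheb_rec)

text \<open>This is the recurrence of the Chebyshev polynomials at \<open>X = c1 * c2 - 2\<close>, split into two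
  steps.\<close>

lemma a_seq_rec:
  "a_seq c1 c2 (Suc (Suc l)) = (if even l then c1 else c2) * a_seq c1 c2 (Suc l) - a_seq c1 c2 l"
proof (cases "even l")
  case True
  then obtain k where l: "l = 2 * k" by blast
  show ?thesis
  proof (cases k)
    case 0
    then show ?thesis by (simp add: l a_seq_def poly_chebyshev_P)
  next
    case (Suc k')
    then show ?thesis
      by (simp add: l a_seq_def Let_def algebra_simps)
  qed
next
  case False
  then obtain k where l: "l = 2 * k + 1" using oddE by blast
  show ?thesis
  proof (cases k)
    case 0
    then show ?thesis by (simp add: l a_seq_def poly_chebyshev_P)
  next
    case (Suc k')
    then show ?thesis
      by (simp add: l a_seq_def Let_def poly_chebyshev_P algebra_simps)
  qed
qed

lemma a'_seq_eq_a_seq_swap: "a'_seq c1 c2 l = a_seq c2 c1 l"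
  by (simp add: a'_seq_def a_seq_def Let_def mult.commute)

lemma a_seq_swap:
  "odd l \<Longrightarrow> a_seq c2 c1 l = a_seq c1 c2 l"
  "even l \<Longrightarrow> c1 * a_seq c2 c1 l = c2 * a_seq c1 c2 l"
  by (auto simp: a_seq_def Let_def mult.commute)

lemma a_seq_pos:
  assumes "c1 > 0" "c2 > 0" "c1 * c2 \<ge> 4" "l \<ge> 1"
  shows "a_seq c1 c2 l > 0"
proof -
  obtain l' where l': "l = Suc l'" using assms(4) by (cases l) auto
  have "0 < a_seq c1 c2 (Suc l')"
    by (rule three_term_pos[of "\<lambda>l. if even l then c1 else c2"])
       (use assms in \<open>auto simp: a_seq_rec mult.commute\<close>, auto simp: a_seq_def)
  then show ?thesis by (simp add: l')
qed

section \<open>The sequence $l_j$\<close>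

locale rank_two =
  fixes c1 c2 lam1 lam2 :: int
  assumes c1_pos: "c1 > 0" and c2_pos: "c2 > 0" and c_prod: "c1 * c2 \<ge> 4"
    and lam1_pos: "lam1 > 0"
begin

definition cf :: "int \<Rightarrow> int" where
  "cf n = (if odd n then c1 else c2)"

lemma cf_pos: "cf n > 0"
  using c1_pos c2_pos by (simp add: cf_def)

lemma cf_prod: "cf n * cf (n + 1) \<ge> 4"
  using c_prod by (auto simp: cf_def mult.commute)

lemma cf_diff_2 [simp]: "cf (n - 2) = cf n"
  by (simp add: cf_def)

definition ell :: "int \<Rightarrow> int" where
  "ell n = (if n \<le> 0 then 0 else l_seq c1 c2 lam1 lam2 (nat n))"

lemma ell_nat: "ell (int j) = (if j = 0 then 0 else l_seq c1 c2 lam1 lam2 j)"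
  by (simp add: ell_def)

text \<open>The inhomogeneous terms at \<open>n = -1\<close> and \<open>n = 0\<close> produce \<open>ell 1 = lam1\<close> and
  \<open>ell 2 = c2 * lam1 + lam2\<close> from the zeros at nonpositive positions. They match
  the terms of \<open>s_rec\<close> below.\<close>

lemma ell_rec:
  "ell (n + 2) = cf n * ell (n + 1) - ell n
     + (if n = -1 then lam1 else if n = 0 then lam2 else 0)"
proof -
  consider "n \<le> -2" | "n = -1" | "n = 0" | "n \<ge> 1" by linarith
  then show ?thesis
  proof cases
    case 4
    define m where "m = nat n"
    have n: "n = int m" "m \<ge> 1" using 4 by (auto simp: m_def)
    obtain m' where m': "m = Suc m'" using n by (cases m) auto
    have idx: "nat n = Suc m'" "nat (n + 1) = Suc (Suc m')" "nat (n + 2) = Suc (Suc (Suc m'))"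
      using n m' by simp_all
    have "even n \<longleftrightarrow> odd m'" using n m' by simp
    show ?thesis
    proof (cases "even m'")
      case True
      have "c1 * (lam1 * a_seq c2 c1 m') = c2 * (lam1 * a_seq c1 c2 m')"
        using a_seq_swap(2)[OF True, of c1 c2] by (metis mult.left_commute)
      moreover have "a_seq c2 c1 (Suc m') = a_seq c1 c2 (Suc m')"
        using True by (intro a_seq_swap(1)) simp
      ultimately show ?thesis
        using 4 True \<open>even n \<longleftrightarrow> odd m'\<close> unfolding ell_def idx
        by (simp add: l_seq_def a'_seq_eq_a_seq_swap a_seq_rec cf_def algebra_simps)
    next
      case False
      have swap: "c1 * (u * a_seq c2 c1 (Suc m')) = c2 * (u * a_seq c1 c2 (Suc m'))" for u
        using a_seq_swap(2)[of "Suc m'" c1 c2] False by (metis even_Suc mult.left_commute)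
      have swap': "c1 * (c2 * (lam1 * a_seq c2 c1 (Suc m'))) = c2 * (c2 * (lam1 * a_seq c1 c2 (Suc m')))"
        using swap[of "c2 * lam1"] by (simp only: mult.assoc)
      show ?thesis
        using 4 False \<open>even n \<longleftrightarrow> odd m'\<close> a_seq_swap(1)[OF False, of c1 c2] unfolding ell_def idx
        by (simp add: l_seq_def a'_seq_eq_a_seq_swap a_seq_rec cf_def algebra_simps swap swap')
    qed
  qed (simp_all add: ell_def l_seq_def cf_def a_seq_def a'_seq_def poly_chebyshev_P numeral_2_eq_2)
qed

text \<open>At a sign change the negated sequence starts with \<open>u 0 \<ge> 0\<close> and \<open>u 1 \<ge> cf n * u 0\<close>, which is
  fast enough growth for \<open>three_term_nonneg\<close>.\<close>

lemma ell_nonpos_persists: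
  assumes "n \<ge> 1" "ell n > 0" "ell (n + 1) \<le> 0"
  shows "ell (n + 1 + int t) \<le> 0"
proof -
  define u where "u t = - ell (n + 1 + int t)" for t
  define d where "d t = cf (n + 1 + int t)" for t
  have rec: "u (Suc (Suc l)) = d l * u (Suc l) - u l" for l
    using ell_rec[of "n + 1 + int l"] assms(1) by (simp add: u_def d_def algebra_simps)
  have "ell (n + 2) = cf n * ell (n + 1) - ell n"
    using ell_rec[of n] assms(1) by simp
  then have u1: "u 1 = cf n * u 0 + ell n" by (simp add: u_def algebra_simps)
  have u0: "0 \<le> u 0" using assms(3) by (simp add: u_def)
  have "d 0 * u 1 = (cf n * cf (n + 1)) * u 0 + d 0 * ell n"
    unfolding u1 by (simp add: d_def algebra_simps)
  moreover have "4 * u 0 \<le> (cf n * cf (n + 1)) * u 0"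
    using cf_prod u0 by (intro mult_right_mono)
  moreover have "0 \<le> d 0 * ell n" using cf_pos assms(2) by (simp add: d_def less_imp_le)
  ultimately have "2 * u 0 \<le> d 0 * u 1" using u0 by linarith
  moreover have "d l * d (Suc l) \<ge> 4" for l
    using cf_prod[of "n + 1 + int l"] by (simp add: d_def algebra_simps)
  moreover have "d l > 0" for l by (simp add: d_def cf_pos)
  ultimately have "0 \<le> u t" using three_term_nonneg[of d u t] rec u0 by blast
  then show ?thesis by (simp add: u_def)
qed

lemma ell_pos_below:
  assumes "ell (int j) > 0" "1 \<le> m" "m \<le> j"
  shows "ell (int m) > 0"
  using assms(2,3)
proof (induction m rule: dec_induct)
  case base
  then show ?case using lam1_pos by (simp add: ell_def l_seq_def a_seq_def)
next
  case (step m)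
  show ?case
  proof (rule ccontr)
    assume "\<not> ?thesis"
    then have "ell (int m + 1 + int (j - Suc m)) \<le> 0"
      using step by (intro ell_nonpos_persists) (auto simp: add.commute)
    moreover have "int m + 1 + int (j - Suc m) = int j" using step by simp
    ultimately show False using assms(1) by simp
  qed
qed

section \<open>The crystal operators after closing the gap at position 0\<close>

text \<open>The nonzero positions are renumbered by all integers, in order, so that colours strictly
  alternate also across $t_\lambda$: the colour of \<open>pos n\<close> is decided by the parity of \<open>n\<close>.\<close>

definition pos :: "int \<Rightarrow> int" where
  "pos n = (if n \<ge> 1 then n else n - 1)"

definition col :: "int \<Rightarrow> idx" where
  "col n = (if odd n then I1 else I2)"

definition s :: "(int \<Rightarrow> int) \<Rightarrow> int \<Rightarrow> int" where
  "s x n = sigma c1 c2 lam1 lam2 x (pos n)"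

lemma pos_less_iff [simp]: "pos m < pos n \<longleftrightarrow> m < n"
  by (auto simp: pos_def)

lemma pos_le_iff [simp]: "pos m \<le> pos n \<longleftrightarrow> m \<le> n"
  by (auto simp: pos_def)

lemma pos_eq_iff [simp]: "pos m = pos n \<longleftrightarrow> m = n"
  by (auto simp: pos_def)

lemma pos_nonzero [simp]: "pos n \<noteq> 0"
  by (auto simp: pos_def)

lemma pos_surj: "k \<noteq> 0 \<Longrightarrow> \<exists>n. k = pos n"
  by (rule exI[of _ "if k > 0 then k else k + 1"]) (auto simp: pos_def)

lemma iota_pos [simp]: "iota (pos n) = col n"
  by (auto simp: iota_def pos_def col_def)

lemma positions_eq: "positions i = pos ` {n. col n = i}"
  by (auto simp: positions_def image_iff) (metis iota_pos pos_surj)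

lemma Zinf_upd: "x \<in> Zinf \<Longrightarrow> x(pos n := v) \<in> Zinf"
proof -
  assume x: "x \<in> Zinf"
  have "{k. (x(pos n := v)) k \<noteq> 0} \<subseteq> insert (pos n) {k. x k \<noteq> 0}" by auto
  moreover have "finite (insert (pos n) {k. x k \<noteq> 0})" using x by (simp add: Zinf_def)
  ultimately have "finite {k. (x(pos n := v)) k \<noteq> 0}" by (rule finite_subset)
  then show ?thesis using x pos_nonzero[of n] by (simp add: Zinf_def del: pos_nonzero)
qed

lemma Zinf_bounded:
  assumes "x \<in> Zinf"
  obtains N :: int where "N \<ge> 1" "\<And>k. \<bar>k\<bar> > N \<Longrightarrow> x k = 0"
proof -
  define A where "A = insert 1 (abs ` {k. x k \<noteq> 0})"
  have fin: "finite A" using assms by (simp add: A_def Zinf_def)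
  show ?thesis
  proof
    show "Max A \<ge> 1" using fin by (rule Max_ge) (simp add: A_def)
    show "x k = 0" if "\<bar>k\<bar> > Max A" for k
    proof (rule ccontr)
      assume "x k \<noteq> 0"
      then have "\<bar>k\<bar> \<le> Max A" using fin by (intro Max_ge) (auto simp: A_def)
      then show False using that by simp
    qed
  qed
qed

text \<open>Summing over an interval with a common upper end makes sums for different
  positions or different vectors comparable.\<close>

lemma s_eq_sum:
  assumes x: "x \<in> Zinf" and N: "\<forall>k > N. x k = 0"
  shows "s x n = (if n \<le> 0 then - weight_pairing lam1 lam2 (col n) else 0) + x (pos n)
     + (\<Sum>j \<in> {pos n<..N}. cartan c1 c2 (col n) (iota j) * x j)"
proof -
  have "(\<Sum>j \<in> {j. j > pos n \<and> j \<noteq> 0 \<and> x j \<noteq> 0}. cartan c1 c2 (col n) (iota j) * x j)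
      = (\<Sum>j \<in> {pos n<..N}. cartan c1 c2 (col n) (iota j) * x j)"
    using x N by (intro sum.mono_neutral_left) (auto simp: Zinf_def not_less[symmetric])
  moreover have "pos n < 0 \<longleftrightarrow> n \<le> 0" by (auto simp: pos_def)
  ultimately show ?thesis by (simp add: s_def sigma_def)
qed

text \<open>Between two neighbours of the same colour there is one position of the other colour, so all
  other terms cancel. The weight remains only when \<open>n\<close> and \<open>n + 2\<close> lie on different
  sides of $t_\lambda$.\<close>

lemma s_rec:
  assumes x: "x \<in> Zinf"
  shows "s x n - s x (n + 2) = x (pos n) - cf n * x (pos (n + 1)) + x (pos (n + 2))
           - (if n = -1 then lam1 else if n = 0 then lam2 else 0)"
proof -
  obtain N0 where N0: "N0 \<ge> 1" "\<And>k. \<bar>k\<bar> > N0 \<Longrightarrow> x k = 0" using Zinf_bounded[OF x] by blast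
  define N where "N = max N0 (pos (n + 2))"
  have N: "\<forall>k > N. x k = 0" using N0 by (auto simp: N_def)
  let ?g = "\<lambda>j. cartan c1 c2 (col n) (iota j) * x j"
  have col: "col (n + 2) = col n" by (simp add: col_def)
  have x0: "x 0 = 0" using x by (simp add: Zinf_def)
  have "{pos n<..N} = {pos n<..pos (n + 2)} \<union> {pos (n + 2)<..N}"
    by (auto simp: N_def) (use pos_less_iff[of n "n + 2"] in linarith)
  then have split: "sum ?g {pos n<..N} = sum ?g {pos n<..pos (n + 2)} + sum ?g {pos (n + 2)<..N}"
    by (simp add: sum.union_disjoint)
  have "sum ?g {pos n<..pos (n + 2)} = sum ?g {pos (n + 1), pos (n + 2)}"
  proof (intro sum.mono_neutral_right ballI)
    fix i assume "i \<in> {pos n<..pos (n + 2)} - {pos (n + 1), pos (n + 2)}"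
    then have "i = 0" by (auto simp: pos_def split: if_splits)
    then show "?g i = 0" using x0 by simp
  qed (auto simp: pos_def)
  also have "\<dots> = 2 * x (pos (n + 2)) - cf n * x (pos (n + 1))"
    by (auto simp: cartan_def cf_def col_def)
  finally have sm: "sum ?g {pos n<..pos (n + 2)} = 2 * x (pos (n + 2)) - cf n * x (pos (n + 1))" .
  show ?thesis
    unfolding s_eq_sum[OF x N] col split sm
    by (auto simp: weight_pairing_def col_def)
qed

lemma s_upd:
  assumes x: "x \<in> Zinf" and col: "col m = col n"
  shows "s (x(pos n := x (pos n) + v)) m
       = s x m + (if m = n then v else if m < n then 2 * v else 0)"
proof -
  obtain N0 where N0: "N0 \<ge> 1" "\<And>k. \<bar>k\<bar> > N0 \<Longrightarrow> x k = 0" using Zinf_bounded[OF x] by blast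
  define N where "N = max N0 (pos n)"
  have N: "\<forall>k > N. x k = 0" using N0 by (auto simp: N_def)
  let ?y = "x(pos n := x (pos n) + v)"
  have y: "?y \<in> Zinf" by (rule Zinf_upd[OF x])
  have Ny: "\<forall>k > N. ?y k = 0" using N by (auto simp: N_def)
  have "(\<Sum>j \<in> {pos m<..N}. cartan c1 c2 (col m) (iota j) * ?y j)
      = (\<Sum>j \<in> {pos m<..N}. cartan c1 c2 (col m) (iota j) * x j + (if j = pos n then 2 * v else 0))"
    by (intro sum.cong) (auto simp: col cartan_def)
  also have "\<dots> = (\<Sum>j \<in> {pos m<..N}. cartan c1 c2 (col m) (iota j) * x j)
      + (if m < n then 2 * v else 0)"
    by (auto simp: sum.distrib N_def)
  finally show ?thesis
    unfolding s_eq_sum[OF x N] s_eq_sum[OF y Ny] by auto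
qed

lemma s_above:
  assumes x: "x \<in> Zinf" and j: "j \<ge> 1" and X: "\<forall>n > j. x (pos n) = 0"
  shows "n > j \<Longrightarrow> s x n = 0" and "s x j = x (pos j)"
proof -
  have N: "\<forall>k > j. x k = 0" using X j by (fastforce simp: pos_def)
  show "n > j \<Longrightarrow> s x n = 0" "s x j = x (pos j)"
    unfolding s_eq_sum[OF x N] using j X by (auto simp: pos_def)
qed

definition top_at :: "(int \<Rightarrow> int) \<Rightarrow> int \<Rightarrow> bool" where
  "top_at x n \<longleftrightarrow> (\<forall>m. col m = col n \<longrightarrow> s x m \<le> s x n)"

lemma Mset_eq:
  assumes x: "x \<in> Zinf"
  shows "Mset c1 c2 lam1 lam2 i x = pos ` {n. col n = i \<and> top_at x n}"
proof -
  have fin: "finite (s x ` {n. col n = i})"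
    using finite_sigma_image[OF x, of c1 c2 lam1 lam2 "positions i"]
    by (simp add: positions_eq s_def[abs_def] image_image)
  have M: "sigma_max c1 c2 lam1 lam2 i x = Max (s x ` {n. col n = i})"
    by (simp add: sigma_max_def positions_eq s_def[abs_def] image_image)
  have top: "s x n = Max (s x ` {n. col n = i}) \<longleftrightarrow> top_at x n" if "col n = i" for n
  proof -
    have "s x ` {n. col n = i} \<noteq> {}" using that by blast
    from eq_Max_iff[OF fin this] show ?thesis using that by (auto simp: top_at_def)
  qed
  show ?thesis
    unfolding Mset_def M positions_eq using top by (fastforce simp flip: s_def)
qed

lemma ex_top_at:
  assumes x: "x \<in> Zinf"
  shows "\<exists>n. col n = i \<and> top_at x n"
proof -
  have fin: "finite (s x ` {n. col n = i})"
    using finite_sigma_image[OF x, of c1 c2 lam1 lam2 "positions i"]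
    by (simp add: positions_eq s_def[abs_def] image_image)
  have "col (if i = I1 then 1 else 0) = i" by (cases i) (auto simp: col_def)
  then have "s x ` {n. col n = i} \<noteq> {}" by blast
  then have "Max (s x ` {n. col n = i}) \<in> s x ` {n. col n = i}" using fin by (intro Max_in)
  then obtain n where "col n = i" "s x n = Max (s x ` {n. col n = i})" by auto
  then have "top_at x n" unfolding top_at_def using Max_ge[OF fin] by auto
  then show ?thesis using \<open>col n = i\<close> by blast
qed

text \<open>\<open>e_at x n\<close> and \<open>f_at x n\<close> mean that $\tilde e_i$, respectively $\tilde f_i$, acts on \<open>x\<close> at
  position \<open>pos n\<close>, where \<open>i\<close> is the colour of \<open>n\<close>: this position is the greatest, respectively
  the least, element of $M^{(i)}$.\<close>

definition e_at :: "(int \<Rightarrow> int) \<Rightarrow> int \<Rightarrow> bool" where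
  "e_at x n \<longleftrightarrow> (\<forall>m. col m = col n \<longrightarrow> s x m \<le> s x n \<and> (m > n \<longrightarrow> s x m < s x n))"

definition f_at :: "(int \<Rightarrow> int) \<Rightarrow> int \<Rightarrow> bool" where
  "f_at x n \<longleftrightarrow> (\<forall>m. col m = col n \<longrightarrow> s x m \<le> s x n \<and> (m < n \<longrightarrow> s x m < s x n))"

lemma e_at_iff:
  "e_at x n \<longleftrightarrow> top_at x n \<and> (\<forall>m. col m = col n \<and> top_at x m \<longrightarrow> m \<le> n)"
proof
  assume n: "e_at x n"
  have "m \<le> n" if "col m = col n" "top_at x m" for m
  proof (rule ccontr)
    assume "\<not> m \<le> n"
    then have "s x m < s x n" using n that by (auto simp: e_at_def)
    moreover have "s x n \<le> s x m" using that by (simp add: top_at_def)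
    ultimately show False by simp
  qed
  then show "top_at x n \<and> (\<forall>m. col m = col n \<and> top_at x m \<longrightarrow> m \<le> n)"
    using n by (auto simp: e_at_def top_at_def)
next
  assume n: "top_at x n \<and> (\<forall>m. col m = col n \<and> top_at x m \<longrightarrow> m \<le> n)"
  have "s x m < s x n" if "col m = col n" "n < m" for m
  proof (rule ccontr)
    assume "\<not> s x m < s x n"
    then have "top_at x m" using n that by (force simp: top_at_def)
    then show False using n that by auto
  qed
  then show "e_at x n" using n by (auto simp: e_at_def top_at_def)
qed

lemma f_at_iff:
  "f_at x n \<longleftrightarrow> top_at x n \<and> (\<forall>m. col m = col n \<and> top_at x m \<longrightarrow> n \<le> m)"
proof
  assume n: "f_at x n"
  have "n \<le> m" if "col m = col n" "top_at x m" for m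
  proof (rule ccontr)
    assume "\<not> n \<le> m"
    then have "s x m < s x n" using n that by (auto simp: f_at_def)
    moreover have "s x n \<le> s x m" using that by (simp add: top_at_def)
    ultimately show False by simp
  qed
  then show "top_at x n \<and> (\<forall>m. col m = col n \<and> top_at x m \<longrightarrow> n \<le> m)"
    using n by (auto simp: f_at_def top_at_def)
next
  assume n: "top_at x n \<and> (\<forall>m. col m = col n \<and> top_at x m \<longrightarrow> n \<le> m)"
  have "s x m < s x n" if "col m = col n" "m < n" for m
  proof (rule ccontr)
    assume "\<not> s x m < s x n"
    then have "top_at x m" using n that by (force simp: top_at_def)
    then show False using n that by auto
  qed
  then show "f_at x n" using n by (auto simp: f_at_def top_at_def)
qed

lemma e_op_Some_iff:
  assumes x: "x \<in> Zinf"
  shows "e_op c1 c2 lam1 lam2 i x = Some y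
     \<longleftrightarrow> (\<exists>n. col n = i \<and> e_at x n \<and> y = x(pos n := x (pos n) - 1))"
proof (cases "\<exists>n. col n = i \<and> e_at x n")
  case True
  then obtain n where n: "col n = i" "e_at x n" by blast
  have M: "pos n \<in> Mset c1 c2 lam1 lam2 i x"
    using n by (simp add: Mset_eq[OF x] e_at_iff)
  have le: "k \<le> pos n" if "k \<in> Mset c1 c2 lam1 lam2 i x" for k
    using n that by (auto simp: Mset_eq[OF x] e_at_iff)
  have "(GREATEST k. k \<in> Mset c1 c2 lam1 lam2 i x) = pos n"
    using M le by (rule Greatest_equality)
  moreover have "\<exists>m\<in>Mset c1 c2 lam1 lam2 i x. \<forall>k\<in>Mset c1 c2 lam1 lam2 i x. k \<le> m"
    using M le by blast
  ultimately have op: "e_op c1 c2 lam1 lam2 i x = Some (x(pos n := x (pos n) - 1))"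
    by (simp add: e_op_def Let_def)
  have uniq: "n' = n" if "col n' = i" "e_at x n'" for n'
  proof (rule antisym)
    show "n' \<le> n" "n \<le> n'" using n that unfolding e_at_iff by simp_all
  qed
  show ?thesis unfolding op using n uniq by blast
next
  case False
  have "\<not> (\<exists>m\<in>Mset c1 c2 lam1 lam2 i x. \<forall>k\<in>Mset c1 c2 lam1 lam2 i x. k \<le> m)"
  proof
    assume "\<exists>m\<in>Mset c1 c2 lam1 lam2 i x. \<forall>k\<in>Mset c1 c2 lam1 lam2 i x. k \<le> m"
    then obtain n where "col n = i" "top_at x n" "\<forall>m. col m = i \<and> top_at x m \<longrightarrow> m \<le> n"
      by (auto simp: Mset_eq[OF x])
    then show False using False unfolding e_at_iff by blast
  qed
  then have "e_op c1 c2 lam1 lam2 i x = None" unfolding e_op_def by (rule if_not_P)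
  then show ?thesis using False by auto
qed

lemma f_op_Some_iff:
  assumes x: "x \<in> Zinf"
  shows "f_op c1 c2 lam1 lam2 i x = Some y
     \<longleftrightarrow> (\<exists>n. col n = i \<and> f_at x n \<and> y = x(pos n := x (pos n) + 1))"
proof (cases "\<exists>n. col n = i \<and> f_at x n")
  case True
  then obtain n where n: "col n = i" "f_at x n" by blast
  have M: "pos n \<in> Mset c1 c2 lam1 lam2 i x"
    using n by (simp add: Mset_eq[OF x] f_at_iff)
  have le: "pos n \<le> k" if "k \<in> Mset c1 c2 lam1 lam2 i x" for k
    using n that by (auto simp: Mset_eq[OF x] f_at_iff)
  have "(LEAST k. k \<in> Mset c1 c2 lam1 lam2 i x) = pos n"
    using M le by (rule Least_equality)
  moreover have "\<exists>m\<in>Mset c1 c2 lam1 lam2 i x. \<forall>k\<in>Mset c1 c2 lam1 lam2 i x. m \<le> k"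
    using M le by blast
  ultimately have op: "f_op c1 c2 lam1 lam2 i x = Some (x(pos n := x (pos n) + 1))"
    by (simp add: f_op_def Let_def)
  have uniq: "n' = n" if "col n' = i" "f_at x n'" for n'
  proof (rule antisym)
    show "n' \<le> n" "n \<le> n'" using n that unfolding f_at_iff by simp_all
  qed
  show ?thesis unfolding op using n uniq by blast
next
  case False
  have "\<not> (\<exists>m\<in>Mset c1 c2 lam1 lam2 i x. \<forall>k\<in>Mset c1 c2 lam1 lam2 i x. m \<le> k)"
  proof
    assume "\<exists>m\<in>Mset c1 c2 lam1 lam2 i x. \<forall>k\<in>Mset c1 c2 lam1 lam2 i x. m \<le> k"
    then obtain n where "col n = i" "top_at x n" "\<forall>m. col m = i \<and> top_at x m \<longrightarrow> n \<le> m"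
      by (auto simp: Mset_eq[OF x])
    then show False using False unfolding f_at_iff by blast
  qed
  then have "f_op c1 c2 lam1 lam2 i x = None" unfolding f_op_def by (rule if_not_P)
  then show ?thesis using False by auto
qed

text \<open>Lowering the coordinate at \<open>n\<close> lowers $\sigma$ by 1 at \<open>n\<close>, by 2 at the lower positions of the
  same colour and not at all at the higher ones, where it was smaller before. So \<open>n\<close>
  becomes the least position of the maximum. The lemma after this one is the mirror image;
  together they say that the two operators undo each other.\<close>

lemma f_at_after_e:
  assumes x: "x \<in> Zinf" and n: "e_at x n"
  shows "f_at (x(pos n := x (pos n) - 1)) n"
proof -
  have "s (x(pos n := x (pos n) - 1)) m = s x m + (if m = n then -1 else if m < n then -2 else 0)"
    if "col m = col n" for m
    using s_upd[OF x that, of "-1"] by (simp split: if_splits)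
  moreover have "s x m \<le> s x n" "m > n \<Longrightarrow> s x m < s x n" if "col m = col n" for m
    using n that by (auto simp: e_at_def)
  ultimately show ?thesis unfolding f_at_def by (smt (verit))
qed

lemma e_at_after_f:
  assumes x: "x \<in> Zinf" and n: "f_at x n"
  shows "e_at (x(pos n := x (pos n) + 1)) n"
proof -
  have "s (x(pos n := x (pos n) + 1)) m = s x m + (if m = n then 1 else if m < n then 2 else 0)"
    if "col m = col n" for m
    using s_upd[OF x that, of 1] by (simp split: if_splits)
  moreover have "s x m \<le> s x n" "m < n \<Longrightarrow> s x m < s x n" if "col m = col n" for m
    using n that by (auto simp: f_at_def)
  ultimately show ?thesis unfolding e_at_def by (smt (verit))
qed

lemma crystal_edges_iff:
  "(x, y) \<in> crystal_edges c1 c2 lam1 lam2 \<longleftrightarrow> x \<in> Zinf \<and>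
     (\<exists>n. e_at x n \<and> y = x(pos n := x (pos n) - 1) \<or> f_at x n \<and> y = x(pos n := x (pos n) + 1))"
proof (cases "x \<in> Zinf")
  case True
  then show ?thesis
    unfolding crystal_edges_def using e_op_Some_iff[OF True] f_op_Some_iff[OF True] Zinf_upd[OF True]
    by (simp only: mem_Collect_eq prod.case) blast
qed (simp add: crystal_edges_def)

lemma sym_crystal_edges: "sym (crystal_edges c1 c2 lam1 lam2)"
proof (rule symI)
  fix x y assume xy: "(x, y) \<in> crystal_edges c1 c2 lam1 lam2"
  then obtain n where x: "x \<in> Zinf"
    and n: "e_at x n \<and> y = x(pos n := x (pos n) - 1) \<or> f_at x n \<and> y = x(pos n := x (pos n) + 1)"
    by (auto simp: crystal_edges_iff)
  then have "y \<in> Zinf" by (auto simp: Zinf_upd)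
  with n show "(y, x) \<in> crystal_edges c1 c2 lam1 lam2"
    using f_at_after_e[OF x] e_at_after_f[OF x]
    by (auto simp: crystal_edges_iff intro!: exI[of _ n])
qed

lemma B0_eq: "B0 c1 c2 lam1 lam2 = {x. ((\<lambda>_. 0), x) \<in> (crystal_edges c1 c2 lam1 lam2)\<^sup>*}"
  using sym_crystal_edges by (simp add: B0_def sym_conv_converse_eq[THEN iffD1])

section \<open>The deficit\<close>

definition Y :: "(int \<Rightarrow> int) \<Rightarrow> int \<Rightarrow> int" where
  "Y x n = ell n - x (pos n)"

text \<open>The weight terms of \<open>s_rec\<close> and \<open>ell_rec\<close> cancel, so $t_\lambda$ has become invisible.\<close>

lemma s_diff:
  assumes "x \<in> Zinf"
  shows "s x (n + 2) - s x n = Y x n - cf n * Y x (n + 1) + Y x (n + 2)"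
  using s_rec[OF assms, of n] ell_rec[of n] by (simp add: Y_def algebra_simps)

lemma s_const_below:
  assumes x: "x \<in> Zinf" and Y0: "\<And>n. n \<le> N \<Longrightarrow> Y x n = 0"
    and "n \<le> N" "col n = col N"
  shows "s x n = s x N"
proof -
  have "even (N - n)" using assms(4) by (auto simp: col_def split: if_splits)
  then obtain t' where t': "N - n = 2 * t'" by blast
  define t where "t = nat t'"
  have n: "n = N - 2 * int t" using t' assms(3) by (simp add: t_def)
  have "s x (N - 2 * int t) = s x N" for t
  proof (induction t)
    case (Suc t)
    have "s x (N - 2 * int (Suc t) + 2) = s x (N - 2 * int (Suc t))"
      using s_diff[OF x, of "N - 2 * int (Suc t)"] by (simp add: Y0)
    moreover have "N - 2 * int (Suc t) + 2 = N - 2 * int t" by simp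
    ultimately show ?case using Suc by simp
  qed simp
  then show ?thesis by (simp add: n)
qed

section \<open>From the zero vector to the lowest weight vector\<close>

lemma L_vec_pos:
  "L_vec c1 c2 lam1 lam2 j (pos n) = (if n \<le> int j then ell n else 0)"
  by (auto simp: L_vec_def pos_def ell_def)

lemma L_vec_Zinf: "L_vec c1 c2 lam1 lam2 j \<in> Zinf"
proof -
  have "{k. L_vec c1 c2 lam1 lam2 j k \<noteq> 0} \<subseteq> {1..int j}" by (auto simp: L_vec_def)
  then have "finite {k. L_vec c1 c2 lam1 lam2 j k \<noteq> 0}" by (rule finite_subset) simp
  then show ?thesis by (simp add: Zinf_def L_vec_def)
qed

text \<open>Let $0 \le t < l_{m+1}$ be the coordinate at \<open>n = m + 1\<close>. In the colour of \<open>n\<close>, $\sigma$ is 0 above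
  \<open>n\<close>, it is \<open>t\<close> at \<open>n\<close>, and it has the constant value $2t - l_{m+1} < t$ below \<open>n\<close>, because
  there the deficit vanishes. So $\tilde f_i$ acts at \<open>n\<close>.\<close>

lemma L_vec_step:
  assumes "ell (int (Suc m)) \<ge> int t"
  shows "(L_vec c1 c2 lam1 lam2 m, (L_vec c1 c2 lam1 lam2 m)(pos (int (Suc m)) := int t))
           \<in> (crystal_edges c1 c2 lam1 lam2)\<^sup>*"
  using assms
proof (induction t)
  case 0
  have "(L_vec c1 c2 lam1 lam2 m)(pos (int (Suc m)) := 0) = L_vec c1 c2 lam1 lam2 m"
    by (rule fun_upd_idem) (simp add: L_vec_pos)
  then show ?case by simp
next
  case (Suc t)
  let ?n = "int (Suc m)"
  let ?x = "(L_vec c1 c2 lam1 lam2 m)(pos ?n := int t)"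
  have x: "?x \<in> Zinf" by (intro Zinf_upd L_vec_Zinf)
  have top: "s ?x k = 0" if "k > ?n" for k
    using that by (intro s_above(1)[OF x, of ?n]) (auto simp: L_vec_pos)
  have mid: "s ?x ?n = int t"
    by (subst s_above(2)[OF x, of ?n]) (auto simp: L_vec_pos)
  have Y0: "Y ?x k = 0" if "k \<le> int m" for k using that by (auto simp: Y_def L_vec_pos)
  have low: "s ?x k = 2 * int t - ell ?n" if k: "k < ?n" "col k = col ?n" for k
  proof -
    have "k \<le> ?n - 2" using k by (cases "k = ?n - 1") (auto simp: col_def split: if_splits)
    moreover have "col (?n - 2) = col ?n" by (simp add: col_def)
    ultimately have "s ?x k = s ?x (?n - 2)"
      using k Y0 by (intro s_const_below[OF x]) auto
    moreover have "s ?x ?n - s ?x (?n - 2) = Y ?x ?n"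
      using s_diff[OF x, of "?n - 2"] Y0[of "int m - 1"] Y0[of "int m"] by simp
    moreover have "Y ?x ?n = ell ?n - int t" by (simp add: Y_def)
    ultimately show ?thesis using mid by simp
  qed
  have "f_at ?x ?n"
    unfolding f_at_def
  proof (intro allI impI)
    fix k assume k: "col k = col ?n"
    consider "k < ?n" | "k = ?n" | "k > ?n" by linarith
    then show "s ?x k \<le> s ?x ?n \<and> (k < ?n \<longrightarrow> s ?x k < s ?x ?n)"
      using top[of k] low[of k] mid Suc.prems k by cases auto
  qed
  then have "(?x, ?x(pos ?n := ?x (pos ?n) + 1)) \<in> crystal_edges c1 c2 lam1 lam2"
    using x by (auto simp: crystal_edges_iff)
  moreover have "?x(pos ?n := ?x (pos ?n) + 1) = (L_vec c1 c2 lam1 lam2 m)(pos ?n := int (Suc t))"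
    by (simp add: add.commute)
  moreover have "(L_vec c1 c2 lam1 lam2 m, ?x) \<in> (crystal_edges c1 c2 lam1 lam2)\<^sup>*"
    using Suc.prems by (intro Suc.IH) simp
  ultimately show ?case by (metis rtrancl.rtrancl_into_rtrancl)
qed

lemma L_vec_in_B0:
  assumes "ell (int j) > 0" "m \<le> j"
  shows "((\<lambda>_. 0), L_vec c1 c2 lam1 lam2 m) \<in> (crystal_edges c1 c2 lam1 lam2)\<^sup>*"
  using assms(2)
proof (induction m)
  case 0
  have "L_vec c1 c2 lam1 lam2 0 = (\<lambda>_. 0)" by (rule ext) (simp add: L_vec_def)
  then show ?case by simp
next
  case (Suc m)
  have "ell (int (Suc m)) > 0" using Suc.prems by (intro ell_pos_below[OF assms(1)]) auto
  then have t: "int (nat (ell (int (Suc m)))) = ell (int (Suc m))" by simp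
  have eq: "L_vec c1 c2 lam1 lam2 (Suc m)
      = (L_vec c1 c2 lam1 lam2 m)(pos (int (Suc m)) := ell (int (Suc m)))"
  proof
    fix k :: int
    consider "k = int (Suc m)" | "k < int (Suc m)" | "k > int (Suc m)" by linarith
    then show "L_vec c1 c2 lam1 lam2 (Suc m) k
        = ((L_vec c1 c2 lam1 lam2 m)(pos (int (Suc m)) := ell (int (Suc m)))) k"
      by cases (simp_all add: L_vec_def pos_def ell_def)
  qed
  have step: "(L_vec c1 c2 lam1 lam2 m,
      (L_vec c1 c2 lam1 lam2 m)(pos (int (Suc m)) := ell (int (Suc m))))
        \<in> (crystal_edges c1 c2 lam1 lam2)\<^sup>*"
    using L_vec_step[OF eq_refl[OF t]] unfolding t .
  have "((\<lambda>_. 0), L_vec c1 c2 lam1 lam2 m) \<in> (crystal_edges c1 c2 lam1 lam2)\<^sup>*"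
    using Suc.prems by (intro Suc.IH) simp
  then show ?case unfolding eq using step by (rule rtrancl_trans)
qed

section \<open>A polyhedron that contains the component\<close>

text \<open>The coefficients of the inequalities. The parity of the starting position \<open>b\<close> decides which of
  the two sequences obeys the recurrence with \<open>cf (b - l)\<close> in \<open>q_simps\<close>.\<close>

definition q :: "int \<Rightarrow> nat \<Rightarrow> int" where
  "q b l = (if odd b then a_seq c1 c2 l else a'_seq c1 c2 l)"

lemma q_simps [simp]:
  "q b 0 = 0" "q b (Suc 0) = 1"
  "q b (Suc (Suc l)) = cf (b - int l) * q b (Suc l) - q b l"
  by (simp_all add: q_def a'_seq_eq_a_seq_swap a_seq_rec cf_def) (simp_all add: a_seq_def)

lemma q_pos: "q b (Suc l) > 0"
  using a_seq_pos[of c1 c2 "Suc l"] a_seq_pos[of c2 c1 "Suc l"] c1_pos c2_pos c_prod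
  by (simp add: q_def a'_seq_eq_a_seq_swap mult.commute)

lemma q_nonneg: "q b l \<ge> 0"
  using q_pos[of b "l - 1"] by (cases l) auto

text \<open>For fixed \<open>b\<close> this is a chain of functionals that starts with \<open>Y b\<close>; the two adjacent positions
  involved move down with \<open>l\<close>.\<close>

definition phi :: "(int \<Rightarrow> int) \<Rightarrow> int \<Rightarrow> nat \<Rightarrow> int" where
  "phi x b l = q b (Suc l) * Y x (b - int l) - q b l * Y x (b - int l - 1)"

lemma phi_0: "phi x b 0 = Y x b"
  by (simp add: phi_def)

text \<open>The functionals are chosen so that this holds: the $\sigma$-difference is used to
  eliminate the coordinate at \<open>b - l\<close>, the only one with a positive coefficient. Read from right to
  left it eliminates the one with a negative coefficient.\<close>

lemma phi_Suc:
  assumes "x \<in> Zinf"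
  shows "phi x b (Suc l) = phi x b l - q b (Suc l) * (s x (b - int l) - s x (b - int l - 2))"
proof -
  have "s x (b - int l) - s x (b - int l - 2)
      = Y x (b - int l - 2) - cf (b - int l) * Y x (b - int l - 1) + Y x (b - int l)"
    using s_diff[OF assms, of "b - int l - 2"] by simp
  moreover have "b - int (Suc l) = b - int l - 1" "b - int (Suc l) - 1 = b - int l - 2" by simp_all
  ultimately show ?thesis
    unfolding phi_def by (simp only: q_simps) (simp add: algebra_simps)
qed

lemma phi_upd:
  "phi (x(pos n := x (pos n) + v)) b l
     = phi x b l - (if n = b - int l then v * q b (Suc l) else 0)
         + (if n = b - int l - 1 then v * q b l else 0)"
  by (auto simp: phi_def Y_def algebra_simps)

text \<open>The family that starts at \<open>b = j + 1\<close> has the lower bound \<open>ell (j + 1)\<close>, because \<open>Y (j + 1)\<close>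
  equals this number on vectors that vanish above \<open>j\<close>. Its inequality for \<open>l = 1\<close> says that $\sigma$
  is nonnegative at \<open>j - 1\<close>.\<close>

definition phi_bound :: "nat \<Rightarrow> int \<Rightarrow> int" where
  "phi_bound j b = (if b \<le> int j then 0 else ell b)"

definition polyhedron :: "nat \<Rightarrow> (int \<Rightarrow> int) set" where
  "polyhedron j = {x \<in> Zinf. (\<forall>n > int j. x (pos n) = 0) \<and> x (pos (int j)) \<ge> 0
     \<and> (\<forall>b \<le> int j + 1. \<forall>l. phi x b l \<ge> phi_bound j b)}"

text \<open>The positions \<open>j\<close> and \<open>j - 1\<close> carry both colours. So in each colour $\sigma$ is at least 0, its
  value above \<open>j\<close>, at some position up to \<open>j\<close>; this prevents $\tilde f_i$ from acting above \<open>j\<close>.\<close>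

lemma polyhedron_s_nonneg:
  assumes x: "x \<in> polyhedron j" and j: "j \<ge> 1"
  shows "s x (int j) \<ge> 0" "s x (int j - 1) \<ge> 0"
proof -
  have xZ: "x \<in> Zinf" and X: "\<forall>n > int j. x (pos n) = 0"
    using x by (auto simp: polyhedron_def)
  have "s x (int j) = x (pos (int j))" using s_above(2)[OF xZ _ X] j by simp
  then show "s x (int j) \<ge> 0" using x by (simp add: polyhedron_def)
  have "s x (int j + 1) = 0" using s_above(1)[OF xZ _ X, of "int j + 1"] j by simp
  moreover have "phi x (int j + 1) 1 \<ge> ell (int j + 1)"
    using x by (auto simp: polyhedron_def phi_bound_def)
  moreover have "phi x (int j + 1) 0 = ell (int j + 1)"
    using X by (simp add: phi_0 Y_def)
  ultimately show "s x (int j - 1) \<ge> 0"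
    using phi_Suc[OF xZ, of "int j + 1" 0] by simp
qed

text \<open>Raising the coordinate at \<open>n\<close> lowers \<open>Y n\<close>, so only functionals with a positive coefficient at
  \<open>n = b - l\<close> are at risk. But there $\sigma$ at \<open>n\<close> exceeds the value at \<open>n - 2\<close> by at least 1, and
  by \<open>phi_Suc\<close> the inequality for \<open>l + 1\<close> leaves a margin of at least this coefficient.\<close>

lemma polyhedron_f:
  assumes x: "x \<in> polyhedron j" and j: "j \<ge> 1" and n: "f_at x n"
  shows "x(pos n := x (pos n) + 1) \<in> polyhedron j"
proof -
  have xZ: "x \<in> Zinf" and X: "\<forall>n > int j. x (pos n) = 0"
    and phi: "\<And>b l. b \<le> int j + 1 \<Longrightarrow> phi x b l \<ge> phi_bound j b"
    using x by (auto simp: polyhedron_def)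
  have nj: "n \<le> int j"
  proof (rule ccontr)
    assume "\<not> ?thesis"
    then have nj: "n > int j" by simp
    then have "s x n = 0" using s_above(1)[OF xZ _ X] j by simp
    moreover have "col n = col (int j) \<or> col n = col (int j - 1)" by (auto simp: col_def)
    ultimately show False
      using n nj polyhedron_s_nonneg[OF x j] by (auto simp: f_at_def)
  qed
  have "col (n - 2) = col n" by (simp add: col_def)
  then have s: "s x n - s x (n - 2) \<ge> 1" using n unfolding f_at_def by force
  have "phi (x(pos n := x (pos n) + 1)) b l \<ge> phi_bound j b" if b: "b \<le> int j + 1" for b l
  proof -
    have "phi x b l \<ge> phi_bound j b + q b (Suc l)" if "n = b - int l"
    proof -
      have "q b (Suc l) * 1 \<le> q b (Suc l) * (s x n - s x (n - 2))"
        using s q_nonneg by (intro mult_left_mono) auto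
      then show ?thesis using phi_Suc[OF xZ, of b l] phi[OF b, of "Suc l"] that by simp
    qed
    then show ?thesis using phi[OF b, of l] q_nonneg[of b l] by (auto simp: phi_upd)
  qed
  then show ?thesis using x nj Zinf_upd[OF xZ] by (auto simp: polyhedron_def)
qed

text \<open>Dually, only functionals with a negative coefficient at \<open>n = b - l - 1\<close> are at risk, and the
  inequality for \<open>l - 1\<close> provides the margin, as $\sigma$ at \<open>n\<close> exceeds the value at \<open>n + 2\<close>. For
  \<open>l = 0\<close> the coefficient is 0.\<close>

lemma polyhedron_e:
  assumes x: "x \<in> polyhedron j" and j: "j \<ge> 1" and n: "e_at x n"
  shows "x(pos n := x (pos n) - 1) \<in> polyhedron j"
proof -
  have xZ: "x \<in> Zinf" and X: "\<forall>n > int j. x (pos n) = 0"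
    and phi: "\<And>b l. b \<le> int j + 1 \<Longrightarrow> phi x b l \<ge> phi_bound j b"
    using x by (auto simp: polyhedron_def)
  have "col (n + 2) = col n" by (simp add: col_def)
  then have s: "s x n - s x (n + 2) \<ge> 1" using n unfolding e_at_def by force
  have nj: "n \<le> int j"
    using s s_above(1)[OF xZ _ X, of n] s_above(1)[OF xZ _ X, of "n + 2"] j
    by (cases "n \<le> int j") auto
  have "phi (x(pos n := x (pos n) + - 1)) b l \<ge> phi_bound j b" if b: "b \<le> int j + 1" for b l
  proof -
    have "phi x b l \<ge> phi_bound j b + q b l" if nb: "n = b - int l - 1"
    proof (cases l)
      case 0
      then show ?thesis using phi[OF b, of l] by simp
    next
      case (Suc l')
      have n': "b - int l' = n + 2" "b - int l' - 2 = n" using nb Suc by auto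
      have "q b (Suc l') * 1 \<le> q b (Suc l') * (s x n - s x (n + 2))"
        using s q_nonneg by (intro mult_left_mono) auto
      then show ?thesis
        using phi_Suc[OF xZ, of b l'] phi[OF b, of l'] unfolding n' Suc
        by (simp add: algebra_simps)
    qed
    then show ?thesis
      using phi[OF b, of l] q_nonneg[of b "Suc l"] unfolding phi_upd by auto
  qed
  moreover have "x (pos (int j)) \<ge> 1" if "n = int j"
    using s s_above(1)[OF xZ _ X, of "n + 2"] s_above(2)[OF xZ _ X] that j by simp
  moreover have "x (pos (int j)) \<ge> 0" using x by (simp add: polyhedron_def)
  ultimately show ?thesis using X nj Zinf_upd[OF xZ] by (auto simp: polyhedron_def)
qed

lemma L_vec_in_polyhedron:
  assumes "ell (int j) > 0" "ell (int j + 1) \<le> 0"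
  shows "L_vec c1 c2 lam1 lam2 j \<in> polyhedron j"
proof -
  have Y: "Y (L_vec c1 c2 lam1 lam2 j) n = (if n \<le> int j then 0 else ell n)" for n
    by (simp add: Y_def L_vec_pos)
  have "phi (L_vec c1 c2 lam1 lam2 j) b l \<ge> phi_bound j b" if "b \<le> int j + 1" for b l
  proof (cases "b = int j + 1")
    case True
    then show ?thesis using assms(2) by (cases l) (auto simp: phi_def phi_bound_def Y)
  qed (use that in \<open>auto simp: phi_def phi_bound_def Y\<close>)
  then show ?thesis using assms by (auto simp: polyhedron_def L_vec_Zinf L_vec_pos)
qed

lemma B0_subset_polyhedron:
  assumes "ell (int j) > 0" "ell (int j + 1) \<le> 0" and j: "j \<ge> 1"
  shows "B0 c1 c2 lam1 lam2 \<subseteq> polyhedron j"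
proof
  let ?E = "crystal_edges c1 c2 lam1 lam2"
  fix x assume "x \<in> B0 c1 c2 lam1 lam2"
  then have "((\<lambda>_. 0), x) \<in> ?E\<^sup>*" by (simp add: B0_eq)
  moreover have "(L_vec c1 c2 lam1 lam2 j, (\<lambda>_. 0)) \<in> ?E\<^sup>*"
    using L_vec_in_B0[OF assms(1) order_refl] sym_crystal_edges by (meson symE sym_rtrancl)
  ultimately have "(L_vec c1 c2 lam1 lam2 j, x) \<in> ?E\<^sup>*" by (rule rtrancl_trans[rotated])
  then show "x \<in> polyhedron j"
  proof (induction rule: rtrancl_induct)
    case base
    then show ?case using assms(1,2) by (rule L_vec_in_polyhedron)
  next
    case (step y z)
    then show ?case using polyhedron_e[OF _ j] polyhedron_f[OF _ j] by (auto simp: crystal_edges_iff)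
  qed
qed

section \<open>Uniqueness of the lowest weight vector\<close>

lemma f_op_None_iff:
  assumes "x \<in> Zinf"
  shows "(\<forall>i. f_op c1 c2 lam1 lam2 i x = None) \<longleftrightarrow> (\<forall>n. \<not> f_at x n)"
  using f_op_Some_iff[OF assms] by (metis not_Some_eq)

text \<open>With vanishing deficit, $\sigma$ is constant in each colour up to \<open>j\<close>, with a nonnegative value, and
  0 above. So the set $M^{(i)}$ is unbounded below.\<close>

lemma L_vec_not_f_at:
  assumes "ell (int j) > 0" "ell (int j + 1) \<le> 0" and j: "j \<ge> 1"
  shows "\<not> f_at (L_vec c1 c2 lam1 lam2 j) n"
proof
  let ?L = "L_vec c1 c2 lam1 lam2 j"
  assume n: "f_at ?L n"
  have x: "?L \<in> Zinf" by (rule L_vec_Zinf)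
  have P: "?L \<in> polyhedron j" by (rule L_vec_in_polyhedron[OF assms(1,2)])
  have "Y ?L k = 0" if "k \<le> int j" for k using that by (simp add: Y_def L_vec_pos)
  then have low: "s ?L (n - 2) = s ?L n" if "n \<le> int j"
    using that s_diff[OF x, of "n - 2"] by simp
  have "col (n - 2) = col n" by (simp add: col_def)
  then have lt: "s ?L (n - 2) < s ?L n" using n by (simp add: f_at_def)
  then have nj: "n > int j" using low by force
  then have "s ?L n = 0" using s_above(1)[OF x, of "int j"] j by (simp add: L_vec_pos)
  moreover have "col n = col (int j) \<or> col n = col (int j - 1)" by (auto simp: col_def)
  ultimately show False
    using n nj polyhedron_s_nonneg[OF P j] by (auto simp: f_at_def)
qed

text \<open>At the lowest position \<open>n\<close> with nonzero deficit the inequality for \<open>b = n\<close>, \<open>l = 0\<close> gives \<open>Y n > 0\<close>,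
  and this is the amount by which $\sigma$ at \<open>n\<close> exceeds its constant value at the lower positions of
  the same colour. Hence $M^{(i)}$ is bounded below by \<open>n\<close>.\<close>

lemma polyhedron_f_at:
  assumes x: "x \<in> polyhedron j" and ne: "x \<noteq> L_vec c1 c2 lam1 lam2 j"
  shows "\<exists>n. f_at x n"
proof -
  have xZ: "x \<in> Zinf" and X: "\<forall>n > int j. x (pos n) = 0"
    using x by (auto simp: polyhedron_def)
  have "\<exists>n \<le> int j. Y x n \<noteq> 0"
  proof (rule ccontr)
    assume "\<not> ?thesis"
    then have "ell n = x (pos n)" if "n \<le> int j" for n using that by (simp add: Y_def)
    then have "x (pos n) = L_vec c1 c2 lam1 lam2 j (pos n)" for n
      using X by (simp add: L_vec_pos)
    moreover have "x 0 = L_vec c1 c2 lam1 lam2 j 0" using xZ by (simp add: Zinf_def L_vec_def)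
    ultimately have "x k = L_vec c1 c2 lam1 lam2 j k" for k using pos_surj[of k] by metis
    then show False using ne by blast
  qed
  then obtain n0 where n0: "n0 \<le> int j" "Y x n0 \<noteq> 0" by blast
  obtain N where N: "N \<ge> 1" "\<And>k. \<bar>k\<bar> > N \<Longrightarrow> x k = 0" using Zinf_bounded[OF xZ] by blast
  have Ylow: "Y x n = 0" if "n < - N" for n
    using that N by (auto simp: Y_def ell_def pos_def)
  define A where "A = {n. n \<le> int j \<and> Y x n \<noteq> 0}"
  have "A \<subseteq> {- N..int j}" using Ylow by (force simp: A_def)
  then have finA: "finite A" using finite_subset by blast
  have neA: "A \<noteq> {}" using n0 by (auto simp: A_def)
  define n where "n = Min A"
  have nA: "n \<in> A" unfolding n_def using finA neA by (rule Min_in)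
  have below: "Y x m = 0" if "m < n" for m
  proof (rule ccontr)
    assume "Y x m \<noteq> 0"
    then have "m \<in> A" using that nA by (auto simp: A_def)
    then have "n \<le> m" unfolding n_def using finA by simp
    then show False using that by simp
  qed
  have nj: "n \<le> int j" using nA by (simp add: A_def)
  then have "n \<le> int j + 1" by simp
  moreover have "\<forall>b \<le> int j + 1. \<forall>l. phi x b l \<ge> phi_bound j b"
    using x by (simp add: polyhedron_def)
  ultimately have "phi_bound j n \<le> phi x n 0" by blast
  then have "phi x n 0 \<ge> 0" using nj by (simp add: phi_bound_def)
  then have Yn: "Y x n > 0" using nA by (simp add: phi_0 A_def)
  have "s x n - s x (n - 2) = Y x n"
    using s_diff[OF xZ, of "n - 2"] below by simp
  then have gap: "s x (n - 2) < s x n" using Yn by simp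
  have low: "s x m < s x n" if "m < n" "col m = col n" for m
  proof -
    have "m \<le> n - 2" using that by (cases "m = n - 1") (auto simp: col_def split: if_splits)
    moreover have "col (n - 2) = col n" by (simp add: col_def)
    ultimately have "s x m = s x (n - 2)"
      using that below by (intro s_const_below[OF xZ]) auto
    then show ?thesis using gap by simp
  qed
  define T where "T = {m. col m = col n \<and> top_at x m}"
  have Tn: "n \<le> m" if "m \<in> T" for m
  proof (rule ccontr)
    assume "\<not> n \<le> m"
    then have "s x m < s x n" using that low[of m] by (simp add: T_def)
    moreover have "s x n \<le> s x m" using that by (simp add: T_def top_at_def)
    ultimately show False by simp
  qed
  obtain m0 where m0: "m0 \<in> T" using ex_top_at[OF xZ] by (auto simp: T_def)
  \<comment> \<open>The integers are not well-ordered; the least element of \<open>T\<close> is found by counting from the lower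
    bound \<open>n\<close>.\<close>
  define m where "m = n + int (LEAST t. n + int t \<in> T)"
  have "n + int (nat (m0 - n)) \<in> T" using m0 Tn[OF m0] by simp
  then have "m \<in> T" unfolding m_def by (rule LeastI)
  moreover have "m \<le> m'" if "m' \<in> T" for m'
  proof -
    have "n + int (nat (m' - n)) \<in> T" using that Tn[OF that] by simp
    then have "(LEAST t. n + int t \<in> T) \<le> nat (m' - n)" by (rule Least_le)
    then show ?thesis using Tn[OF that] by (simp add: m_def)
  qed
  ultimately have "f_at x m" unfolding f_at_iff T_def by simp
  then show ?thesis by blast
qed

text \<open>Both parts of the final theorem are instances, for odd and for even \<open>j\<close>.\<close>

lemma lowest_weight_vector_iff:
  assumes "ell (int j) > 0" "ell (int j + 1) \<le> 0" "j \<ge> 1"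
  shows "lowest_weight_vector c1 c2 lam1 lam2 (B0 c1 c2 lam1 lam2) b
           \<longleftrightarrow> b = L_vec c1 c2 lam1 lam2 j"
proof
  assume b: "lowest_weight_vector c1 c2 lam1 lam2 (B0 c1 c2 lam1 lam2) b"
  then have P: "b \<in> polyhedron j"
    using B0_subset_polyhedron[OF assms] by (auto simp: lowest_weight_vector_def)
  then have "b \<in> Zinf" by (simp add: polyhedron_def)
  then have "\<forall>n. \<not> f_at b n" using b f_op_None_iff by (simp add: lowest_weight_vector_def)
  then show "b = L_vec c1 c2 lam1 lam2 j" using polyhedron_f_at[OF P] by blast
next
  assume "b = L_vec c1 c2 lam1 lam2 j"
  then show "lowest_weight_vector c1 c2 lam1 lam2 (B0 c1 c2 lam1 lam2) b"
    using L_vec_in_B0[OF assms(1) order_refl] L_vec_not_f_at[OF assms] f_op_None_iff[OF L_vec_Zinf]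
    by (simp add: lowest_weight_vector_def B0_eq)
qed

end

section \<open>The conditions on the ratio of the weights\<close>

lemma ratio_less_iff:
  fixes a b lam1 lam2 :: int
  assumes "b > 0" "lam2 < 0"
  shows "real_of_int a / real_of_int b < real_of_int lam1 / real_of_int (- lam2)
     \<longleftrightarrow> 0 < b * lam1 + a * lam2"
proof -
  have "real_of_int a / real_of_int b < real_of_int lam1 / real_of_int (- lam2)
      \<longleftrightarrow> real_of_int a * real_of_int (- lam2) < real_of_int lam1 * real_of_int b"
  proof -
    have "real_of_int b > 0" "real_of_int (- lam2) > 0" using assms by simp_all
    then show ?thesis
      by (simp only: pos_divide_less_eq times_divide_eq_left pos_less_divide_eq)
  qed
  also have "\<dots> \<longleftrightarrow> a * (- lam2) < lam1 * b"
    unfolding of_int_mult[symmetric] of_int_less_iff ..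
  also have "\<dots> \<longleftrightarrow> 0 < b * lam1 + a * lam2" by (simp add: algebra_simps) linarith
  finally show ?thesis .
qed

theorem theorem4p14:
  fixes c1 c2 lam1 lam2 :: int and k :: nat
  assumes "c1 > 0" and "c2 > 0" and "c1 * c2 \<ge> 4"
    and "lam1 > 0" and "lam2 < 0"
    and "k \<ge> 1"
  shows
    "(real_of_int (a_seq c1 c2 (2 * k - 2)) / real_of_int (a_seq c1 c2 (2 * k - 1))
         < real_of_int lam1 / real_of_int (- lam2)
      \<and> real_of_int lam1 / real_of_int (- lam2)
         \<le> real_of_int (a'_seq c1 c2 (2 * k - 1)) / real_of_int (a'_seq c1 c2 (2 * k))
      \<longrightarrow> lowest_weight_vector c1 c2 lam1 lam2 (B0 c1 c2 lam1 lam2)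
             (L_vec c1 c2 lam1 lam2 (2 * k - 1))
          \<and> (\<forall>b. lowest_weight_vector c1 c2 lam1 lam2 (B0 c1 c2 lam1 lam2) b
                 \<longrightarrow> b = L_vec c1 c2 lam1 lam2 (2 * k - 1)))
   \<and> (real_of_int (a'_seq c1 c2 (2 * k - 1)) / real_of_int (a'_seq c1 c2 (2 * k))
         < real_of_int lam1 / real_of_int (- lam2)
      \<and> real_of_int lam1 / real_of_int (- lam2)
         \<le> real_of_int (a_seq c1 c2 (2 * k)) / real_of_int (a_seq c1 c2 (2 * k + 1))
      \<longrightarrow> lowest_weight_vector c1 c2 lam1 lam2 (B0 c1 c2 lam1 lam2)
             (L_vec c1 c2 lam1 lam2 (2 * k))
          \<and> (\<forall>b. lowest_weight_vector c1 c2 lam1 lam2 (B0 c1 c2 lam1 lam2) b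
                 \<longrightarrow> b = L_vec c1 c2 lam1 lam2 (2 * k)))"
proof -
  interpret rank_two c1 c2 lam1 lam2 by unfold_locales (use assms in auto)
  have a: "a_seq c1 c2 l > 0" if "l \<ge> 1" for l using a_seq_pos assms that by blast
  have a': "a'_seq c1 c2 l > 0" if "l \<ge> 1" for l
    using a_seq_pos[of c2 c1 l] assms that by (simp add: a'_seq_eq_a_seq_swap mult.commute)
  let ?r = "real_of_int lam1 / real_of_int (- lam2)"
  have odd: "real_of_int (a_seq c1 c2 l) / real_of_int (a_seq c1 c2 (Suc l)) < ?r
      \<longleftrightarrow> 0 < ell (int (Suc l))" if "even l" for l
    using ratio_less_iff[OF a assms(5), of "Suc l" "a_seq c1 c2 l" lam1] that
    unfolding ell_nat by (simp add: l_seq_def)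
  have even: "real_of_int (a'_seq c1 c2 l) / real_of_int (a'_seq c1 c2 (Suc l)) < ?r
      \<longleftrightarrow> 0 < ell (int (Suc l))" if "odd l" for l
    using ratio_less_iff[OF a' assms(5), of "Suc l" "a'_seq c1 c2 l" lam1] that
    unfolding ell_nat by (simp add: l_seq_def)
  obtain h where k: "k = Suc h" using assms(6) by (cases k) auto
  have idx: "2 * k - 2 = 2 * h" "2 * k - 1 = Suc (2 * h)" "2 * k = Suc (Suc (2 * h))"
    "2 * k + 1 = Suc (Suc (Suc (2 * h)))" by (simp_all add: k)
  have ratios:
    "real_of_int (a_seq c1 c2 (2 * k - 2)) / real_of_int (a_seq c1 c2 (2 * k - 1)) < ?r
       \<longleftrightarrow> ell (int (2 * k - 1)) > 0"
    "real_of_int (a'_seq c1 c2 (2 * k - 1)) / real_of_int (a'_seq c1 c2 (2 * k)) < ?r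
       \<longleftrightarrow> ell (int (2 * k)) > 0"
    "real_of_int (a_seq c1 c2 (2 * k)) / real_of_int (a_seq c1 c2 (2 * k + 1)) < ?r
       \<longleftrightarrow> ell (int (2 * k + 1)) > 0"
    unfolding idx using odd[of "2 * h"] even[of "Suc (2 * h)"] odd[of "Suc (Suc (2 * h))"] by simp_all
  have nxt: "int (2 * k - 1) + 1 = int (2 * k)" "int (2 * k) + 1 = int (2 * k + 1)"
    using assms(6) by simp_all
  show ?thesis
    unfolding ratios not_less[symmetric]
    using lowest_weight_vector_iff[of "2 * k - 1"] lowest_weight_vector_iff[of "2 * k"] assms(6)
    unfolding nxt by (auto simp: not_less)
qed

end
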